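(* Let $p\in[1,2)$, let $P$ be the $(p-1)$-homogeneous operator on $\mathbb{R}^M$ described in the context, let $f\in\mathbb{R}^M$, $f\ne0$, satisfy $P(f)=\lambda f$ with $\lambda<0$, and let $\delta\in(0,2)$. Consider data $\psi_0,\dots,\psi_N$ obtained in either of the following two ways: 1. The time-continuous homogeneous flow $\psi_t=P(\psi)$, $\psi(0)=f$, is sampled as $\psi_k=\psi(t_k)$ at the time points $$t_k=\frac{|1-\delta|^{k(2-p)}}{\lambda(2-p)}-\frac{1}{\lambda(2-p)},\qquad k=0,\dots,N.$$ 2. The explicit scheme $\psi_{k+1}=\psi_k+P(\psi_k)\,dt_k$, $\psi_0=f$, is evolved with the step size $$dt_k=-\frac{\langle P(\psi_k),\psi_k\rangle}{\|P(\psi_k)\|^2}\,\delta .$$ In both cases, applying DMD (with $r=1$) to $\{\psi_k\}_{k=0}^N$ perfectly reconstructs the flow: $ERR^d_{Rec}=0$.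
   Context: Setting. $\mathbb{R}^M$ carries the Euclidean inner product and norm. $R:\mathbb{R}^M\to\mathbb{R}^+$ is absolutely $p$-homogeneous, $R(c\psi)=|c|^pR(\psi)$ for $c\in\mathbb{R}$, and $P=-\partial_\psi R$ is $(p-1)$-homogeneous, $P(c\psi)=c|c|^{p-2}P(\psi)$; $-P$ is maximally monotone. It is known that if $P(f)=\lambda f$ then the solution of $\psi_t=P(\psi)$, $\psi(0)=f$, is $\psi(t)=a(t)f$ with $a(t)=\left[(1+(2-p)\lambda t)^+\right]^{\frac{1}{2-p}}$, where $(x)^+=\max\{0,x\}$. Conventions: $0^0=1$; in the explicit scheme, if $\psi_k=0$ then $\psi_{k+1}=0$. DMD (Dynamic Mode Decomposition) of dimensionality $r$ for data $\psi_0,\dots,\psi_N\in\mathbb{R}^M$. Put $\Psi_0^{N-1}=[\psi_0\ \cdots\ \psi_{N-1}]$, $\Psi_1^N=[\psi_1\ \cdots\ \psi_N]$. Take a singular value decomposition $\Psi_0^{N-1}=U\Sigma V^*$ with singular values in decreasing order and let $U_r$ be the first $r$ columns of $U$. Set $X=U_r^*\Psi_0^{N-1}$, $Y=U_r^*\Psi_1^N$, and let $F=YX^T(XX^T)^{-1}$ be the DMD matrix (the minimizer of the Frobenius norm $\|Y-FX\|_{\mathcal F}^2$). Let $\mu_i$, $w_i$ ($i=1,\dots,r$) be the eigenvalues and (normalized) right eigenvectors of $F$; the modes are $\phi_i=U_rw_i$ and the coordinates are $\alpha_i=w_i^*U_r^*\psi_0$. The discrete-time reconstruction is $\tilde\psi_k=\sum_{i=1}^r\alpha_i\mu_i^k\phi_i$,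 and the reconstruction error is $$ERR^d_{Rec}=\sum_{k=0}^N\|\tilde\psi_k-\psi_k\|^2 .$$ *)

theory Defs
  imports "HOL-Analysis.Analysis" "Jordan_Normal_Form.Char_Poly"
    "Jordan_Normal_Form.Gauss_Jordan_Elimination" "Jordan_Normal_Form.Conjugate"
begin

section \<open>Homogeneous operators and their flows\<close>

definition subdifferential :: "('a::real_inner \<Rightarrow> real) \<Rightarrow> 'a \<Rightarrow> 'a set" where
  "subdifferential R x = {v. \<forall>y. R y \<ge> R x + inner v (y - x)}"

text \<open>Set-valued operators are represented by their graphs.\<close>

definition monotone_graph :: "('a::real_inner \<times> 'a) set \<Rightarrow> bool" where
  "monotone_graph G \<longleftrightarrow> (\<forall>(x, u) \<in> G. \<forall>(y, v) \<in> G. inner (u - v) (x - y) \<ge> 0)"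

definition maximally_monotone :: "('a::real_inner \<times> 'a) set \<Rightarrow> bool" where
  "maximally_monotone G \<longleftrightarrow>
     monotone_graph G \<and> (\<forall>H. monotone_graph H \<and> G \<subseteq> H \<longrightarrow> H = G)"

text \<open>The operator \<open>P = - \<partial>R\<close>. As \<open>R\<close> need not be differentiable (in particular for \<open>p = 1\<close>),
  \<open>P\<close> is a homogeneous selection of the negative subdifferential, and maximal monotonicity is that
  of the full set-valued map \<open>\<partial>R\<close>. (For \<open>p = 1\<close>, requiring it of the graph of the
  single-valued \<open>-P\<close> would force \<open>P\<close> to be continuous, hence \<open>P = 0\<close>.)
  If \<open>R\<close> is convex and differentiable, \<open>P\<close> is the negative gradient of \<open>R\<close>.\<close>

definition homogeneous_operator ::
    "real \<Rightarrow> ('a::real_inner \<Rightarrow> real) \<Rightarrow> ('a \<Rightarrow> 'a) \<Rightarrow> bool" where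
  "homogeneous_operator p R P \<longleftrightarrow>
     (\<forall>x. R x \<ge> 0) \<and>
     (\<forall>c x. R (c *\<^sub>R x) = \<bar>c\<bar> powr p * R x) \<and>
     (\<forall>x. - P x \<in> subdifferential R x) \<and>
     (\<forall>c x. P (c *\<^sub>R x) = (c * \<bar>c\<bar> powr (p - 2)) *\<^sub>R P x) \<and>
     maximally_monotone (SIGMA x:UNIV. subdifferential R x)"

text \<open>Solutions of \<open>u' = P u\<close>, \<open>u 0 = f\<close> on \<open>[0, \<infinity>)\<close> that are locally absolutely continuous and
  satisfy the equation almost everywhere, in integrated form. Classical differentiability at all
  times is too much to ask: for \<open>p = 1\<close> the solution has a kink at its extinction time.\<close>

definition flow_solution ::
    "('a::euclidean_space \<Rightarrow> 'a) \<Rightarrow> 'a \<Rightarrow> (real \<Rightarrow> 'a) \<Rightarrow> bool" where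
  "flow_solution P f u \<longleftrightarrow> u 0 = f \<and>
     (\<forall>t\<ge>0. (\<lambda>s. P (u s)) absolutely_integrable_on {0..t} \<and>
            ((\<lambda>s. P (u s)) has_integral (u t - u 0)) {0..t})"

text \<open>Real powers with the convention \<open>0\<^sup>0 = 1\<close>; the library has \<open>0 powr 0 = 0\<close>.\<close>

definition rpow :: "real \<Rightarrow> real \<Rightarrow> real" where
  "rpow x a = (if a = 0 then 1 else x powr a)"

definition sample_time :: "real \<Rightarrow> real \<Rightarrow> real \<Rightarrow> nat \<Rightarrow> real" where
  "sample_time p lam d k =
     rpow \<bar>1 - d\<bar> (real k * (2 - p)) / (lam * (2 - p)) - 1 / (lam * (2 - p))"

definition sampled_flow ::
    "('a::euclidean_space \<Rightarrow> 'a) \<Rightarrow> 'a \<Rightarrow> (nat \<Rightarrow> real) \<Rightarrow> nat \<Rightarrow> (nat \<Rightarrow> 'a) \<Rightarrow> bool" where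
  "sampled_flow P f t N psi \<longleftrightarrow> (\<exists>u. flow_solution P f u \<and> (\<forall>k\<le>N. psi k = u (t k)))"

definition step_size :: "('a::real_inner \<Rightarrow> 'a) \<Rightarrow> real \<Rightarrow> 'a \<Rightarrow> real" where
  "step_size P d x = - (inner (P x) x / (norm (P x))\<^sup>2) * d"

definition explicit_scheme ::
    "('a::real_inner \<Rightarrow> 'a) \<Rightarrow> 'a \<Rightarrow> real \<Rightarrow> nat \<Rightarrow> (nat \<Rightarrow> 'a) \<Rightarrow> bool" where
  "explicit_scheme P f d N psi \<longleftrightarrow> psi 0 = f \<and>
     (\<forall>k<N. psi (Suc k) =
        (if psi k = 0 then 0 else psi k + step_size P d (psi k) *\<^sub>R P (psi k)))"


section \<open>Dynamic mode decomposition\<close>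

text \<open>Coordinate vector with respect to a fixed enumeration of the index type; it makes
  snapshot matrices with an arbitrary number of columns available.\<close>

definition coords :: "real ^ 'm \<Rightarrow> real Matrix.vec" where
  "coords x = Matrix.vec CARD('m) (\<lambda>i. vec_nth x (from_nat_into UNIV i))"

text \<open>The matrix with columns \<open>psi a, \<dots>, psi (b - 1)\<close>.\<close>

definition snapshots :: "nat \<Rightarrow> nat \<Rightarrow> (nat \<Rightarrow> real ^ 'm) \<Rightarrow> real mat" where
  "snapshots a b psi = mat_of_cols CARD('m) (map (\<lambda>k. coords (psi k)) [a..<b])"

definition is_svd :: "real mat \<Rightarrow> real mat \<Rightarrow> real mat \<Rightarrow> real mat \<Rightarrow> bool" where
  "is_svd A U S V \<longleftrightarrow>
     U \<in> carrier_mat (dim_row A) (dim_row A) \<and>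
     S \<in> carrier_mat (dim_row A) (dim_col A) \<and>
     V \<in> carrier_mat (dim_col A) (dim_col A) \<and>
     transpose_mat U * U = 1\<^sub>m (dim_row A) \<and>
     transpose_mat V * V = 1\<^sub>m (dim_col A) \<and>
     diagonal_mat S \<and>
     (\<forall>i < min (dim_row A) (dim_col A). S $$ (i, i) \<ge> 0) \<and>
     (\<forall>i j. i \<le> j \<and> j < min (dim_row A) (dim_col A) \<longrightarrow> S $$ (i, i) \<ge> S $$ (j, j)) \<and>
     A = U * S * transpose_mat V"

definition leading_cols :: "nat \<Rightarrow> real mat \<Rightarrow> real mat" where
  "leading_cols r U = mat_of_cols (dim_row U) (take r (cols U))"

text \<open>Meaningful when \<open>X * X\<^sup>T\<close> is invertible; otherwise \<open>mat_inverse\<close> returns \<open>None\<close>.\<close>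

definition dmd_matrix :: "nat \<Rightarrow> real mat \<Rightarrow> nat \<Rightarrow> (nat \<Rightarrow> real ^ 'm) \<Rightarrow> real mat" where
  "dmd_matrix r U N psi =
     (let X = transpose_mat (leading_cols r U) * snapshots 0 N psi;
          Y = transpose_mat (leading_cols r U) * snapshots 1 (N + 1) psi
      in Y * transpose_mat X * the (mat_inverse (X * transpose_mat X)))"

text \<open>The eigenvalues of \<open>A\<close> listed with multiplicity, and unit eigenvectors.\<close>

definition eigensystem ::
    "nat \<Rightarrow> complex mat \<Rightarrow> (nat \<Rightarrow> complex) \<Rightarrow> (nat \<Rightarrow> complex Matrix.vec) \<Rightarrow> bool" where
  "eigensystem r A mu w \<longleftrightarrow>
     char_poly A = (\<Prod>i<r. [:- mu i, 1:]) \<and>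
     (\<forall>i<r. eigenvector A (w i) (mu i) \<and> w i \<bullet>c w i = 1)"

definition is_dmd ::
    "nat \<Rightarrow> nat \<Rightarrow> (nat \<Rightarrow> real ^ 'm) \<Rightarrow> real mat \<Rightarrow> (nat \<Rightarrow> complex)
       \<Rightarrow> (nat \<Rightarrow> complex Matrix.vec) \<Rightarrow> bool" where
  "is_dmd r N psi U mu w \<longleftrightarrow>
     (\<exists>S V. is_svd (snapshots 0 N psi) U S V) \<and>
     eigensystem r (map_mat complex_of_real (dmd_matrix r U N psi)) mu w"

definition dmd_mode :: "nat \<Rightarrow> real mat \<Rightarrow> complex Matrix.vec \<Rightarrow> complex Matrix.vec" where
  "dmd_mode r U w = map_mat complex_of_real (leading_cols r U) *\<^sub>v w"

text \<open>\<open>x \<bullet>c w\<close> conjugates its second argument, so this is \<open>w\<^sup>* U\<^sub>r\<^sup>* x\<close>.\<close>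

definition dmd_coordinate ::
    "nat \<Rightarrow> real mat \<Rightarrow> real ^ 'm \<Rightarrow> complex Matrix.vec \<Rightarrow> complex" where
  "dmd_coordinate r U x w =
     map_vec complex_of_real (transpose_mat (leading_cols r U) *\<^sub>v coords x) \<bullet>c w"

definition dmd_reconstruction ::
    "nat \<Rightarrow> (nat \<Rightarrow> real ^ 'm) \<Rightarrow> real mat \<Rightarrow> (nat \<Rightarrow> complex)
       \<Rightarrow> (nat \<Rightarrow> complex Matrix.vec) \<Rightarrow> nat \<Rightarrow> complex Matrix.vec" where
  "dmd_reconstruction r psi U mu w k =
     Matrix.vec CARD('m) (\<lambda>j. \<Sum>i<r.
       dmd_coordinate r U (psi 0) (w i) * mu i ^ k * vec_index (dmd_mode r U (w i)) j)"

definition reconstruction_error ::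
    "nat \<Rightarrow> nat \<Rightarrow> (nat \<Rightarrow> real ^ 'm) \<Rightarrow> real mat \<Rightarrow> (nat \<Rightarrow> complex)
       \<Rightarrow> (nat \<Rightarrow> complex Matrix.vec) \<Rightarrow> real" where
  "reconstruction_error r N psi U mu w =
     (\<Sum>k\<le>N. \<Sum>j<CARD('m).
        (cmod (vec_index (dmd_reconstruction r psi U mu w k) j
               - complex_of_real (vec_index (coords (psi k)) j)))\<^sup>2)"

end

theory Submission
  imports Defs
begin

text \<open>
  In both cases the data are geometric, \<open>\<psi>\<^sub>k = c\<^sup>k f\<close>, with \<open>c = 1 - \<delta>\<close> for the scheme and
  \<open>c = \<bar>1 - \<delta>\<bar>\<close> for the flow. For the flow this needs uniqueness of solutions, which
  follows from the monotonicity of \<open>-P\<close>.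
  The snapshot matrix then has rank one, so its leading left singular vector \<open>u\<close> is
  parallel to \<open>f\<close>. Hence the one-dimensional DMD matrix is multiplication by \<open>c\<close>, and
  projecting onto \<open>u\<close> loses nothing.
\<close>

section \<open>Dissipative integral equations and uniqueness of the flow\<close>

text \<open>
  The increments \<open>|w t|\<^sup>2 - |w s|\<^sup>2 = \<integral> \<langle>k, w s + w t\<rangle>\<close> are telescoped over a fine partition, which avoids
  differentiating \<open>|w|\<^sup>2\<close> almost everywhere.
\<close>

lemma norm_le_of_dissipative_integral:
  fixes w k :: "real \<Rightarrow> 'a::euclidean_space"
  assumes ab: "a \<le> b"
    and k: "k absolutely_integrable_on {a..b}"
    and w: "\<And>t. t \<in> {a..b} \<Longrightarrow> (k has_integral (w t - w a)) {a..t}"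
    and diss: "\<And>t. t \<in> {a..b} \<Longrightarrow> inner (k t) (w t) \<le> 0"
  shows "norm (w b) \<le> norm (w a)"
proof -
  have k_int: "k integrable_on {a..b}" and nk_int: "(\<lambda>t. norm (k t)) integrable_on {a..b}"
    using k by (auto simp: absolutely_integrable_on_def)
  have w_eq: "w t = w a + integral {a..t} k" if "t \<in> {a..b}" for t
    using integral_unique[OF w[OF that]] by simp
  have "continuous_on {a..b} (\<lambda>t. w a + integral {a..t} k)"
    by (intro continuous_intros indefinite_integral_continuous_1 k_int)
  then have "continuous_on {a..b} w"
    using continuous_on_eq w_eq by (metis (no_types, lifting))
  then have unif: "uniformly_continuous_on {a..b} w"
    by (intro compact_uniformly_continuous) auto
  \<comment> \<open>\<open>K\<close> weighs the error made on each partition interval, so that the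
    errors telescope to \<open>2 * e' * K b\<close>.\<close>
  define K where "K s = integral {a..s} (\<lambda>t. norm (k t))" for s
  have "(norm (w b))\<^sup>2 - (norm (w a))\<^sup>2 \<le> e" if "e > 0" for e
  proof -
    have "K b \<ge> 0"
      unfolding K_def by (intro Henstock_Kurzweil_Integration.integral_nonneg nk_int) auto
    \<comment> \<open>Chosen so that the total error \<open>2 * e' * K b\<close> is at most
      \<open>e\<close>; the summand 1 keeps the denominator positive when
      \<open>K b = 0\<close>.\<close>
    define e' where "e' = e / (2 * K b + 1)"
    have "e' > 0" using \<open>e > 0\<close> \<open>K b \<ge> 0\<close> by (simp add: e'_def)
    then obtain \<delta> where "\<delta> > 0" and \<delta>: "\<And>s t. s \<in> {a..b} \<Longrightarrow> t \<in> {a..b} \<Longrightarrow>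
        dist t s < \<delta> \<Longrightarrow> dist (w t) (w s) < e'"
      using unif unfolding uniformly_continuous_on_def by metis
    have step: "(norm (w t))\<^sup>2 - (norm (w s))\<^sup>2 \<le> 2 * e' * (K t - K s)"
      if st: "a \<le> s" "s \<le> t" "t \<le> b" "t - s < \<delta>" for s t
    proof -
      have sub: "k integrable_on {s..t}" "(\<lambda>r. norm (k r)) integrable_on {s..t}"
        using st k_int nk_int by (auto intro: integrable_on_subinterval)
      have inner_int: "((\<lambda>r. inner (k r) y) has_integral inner (integral {s..t} k) y) {s..t}" for y
        using has_integral_linear[OF integrable_integral[OF sub(1)] bounded_linear_inner_left]
        by (simp add: o_def)
      have "integral {a..s} k + integral {s..t} k = integral {a..t} k"
        using st k_int by (intro Henstock_Kurzweil_Integration.integral_combine)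
          (auto intro: integrable_on_subinterval)
      then have dw: "w t - w s = integral {s..t} k"
        using w_eq[of s] w_eq[of t] st by (simp add: algebra_simps)
      have "integral {a..s} (\<lambda>r. norm (k r)) + integral {s..t} (\<lambda>r. norm (k r))
          = integral {a..t} (\<lambda>r. norm (k r))"
        using st nk_int by (intro Henstock_Kurzweil_Integration.integral_combine)
          (auto intro: integrable_on_subinterval)
      then have dK: "K t - K s = integral {s..t} (\<lambda>r. norm (k r))"
        by (simp add: K_def)
      have "(norm (w t))\<^sup>2 - (norm (w s))\<^sup>2 = inner (w t - w s) (w s + w t)"
        by (simp add: power2_norm_eq_inner inner_diff_left inner_add_right inner_commute[of "w s" "w t"])
      also have "\<dots> = integral {s..t} (\<lambda>r. inner (k r) (w s + w t))"
        using inner_int integral_unique by (metis dw)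
      also have "\<dots> \<le> integral {s..t} (\<lambda>r. 2 * e' * norm (k r))"
      proof (rule integral_le)
        show "(\<lambda>r. inner (k r) (w s + w t)) integrable_on {s..t}"
          using inner_int by blast
        show "(\<lambda>r. 2 * e' * norm (k r)) integrable_on {s..t}"
          using sub(2) by (intro integrable_on_mult_right)
        fix r assume r: "r \<in> {s..t}"
        \<comment> \<open>Dissipativity pairs \<open>k r\<close> only with \<open>w r\<close> at the
          same time. Replacing \<open>w r\<close> by its value at an end point of the short interval
          costs at most \<open>e' * norm (k r)\<close>.\<close>
        have near: "inner (k r) (w x) \<le> e' * norm (k r)" if "x \<in> {s, t}" for x
        proof -
          have "dist (w x) (w r) < e'"
            using that r st by (intro \<delta>) (auto simp: dist_real_def)
          have "inner (k r) (w x) = inner (k r) (w r) + inner (k r) (w x - w r)"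
            by (simp add: inner_diff_right)
          also have "\<dots> \<le> 0 + norm (k r) * norm (w x - w r)"
            using r st by (intro add_mono diss norm_cauchy_schwarz) auto
          also have "\<dots> \<le> e' * norm (k r)"
            using \<open>dist (w x) (w r) < e'\<close>
            by (simp add: dist_norm mult.commute[of e'] mult_left_mono)
          finally show ?thesis .
        qed
        show "inner (k r) (w s + w t) \<le> 2 * e' * norm (k r)"
          using near[of s] near[of t] by (simp add: inner_add_right)
      qed
      finally show ?thesis by (simp add: dK)
    qed
    obtain n :: nat where n: "(b - a) / \<delta> < real n"
      using reals_Archimedean2 by blast
    then have "n > 0"
      using ab \<open>\<delta> > 0\<close> by (smt (verit) divide_nonneg_pos of_nat_0_less_iff)
    have mesh: "(b - a) / real n < \<delta>"
      using n \<open>n > 0\<close> \<open>\<delta> > 0\<close> by (simp add: field_simps)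
    \<comment> \<open>Uniform partition of \<open>{a..b}\<close> into \<open>n\<close> pieces, each
      shorter than the modulus of continuity \<open>\<delta>\<close>.\<close>
    define \<tau> where "\<tau> i = a + real i * ((b - a) / real n)" for i
    have "i \<le> n \<Longrightarrow> (norm (w (\<tau> i)))\<^sup>2 - (norm (w a))\<^sup>2 \<le> 2 * e' * K (\<tau> i)" for i
    proof (induction i)
      case 0
      show ?case by (simp add: \<tau>_def K_def)
    next
      case (Suc i)
      have "\<tau> (Suc i) = \<tau> i + (b - a) / real n"
        by (simp add: \<tau>_def distrib_right add_divide_distrib)
      moreover have "a \<le> \<tau> i" using ab by (simp add: \<tau>_def)
      moreover have "\<tau> (Suc i) \<le> b"
      proof -
        have "real (Suc i) * ((b - a) / real n) \<le> real n * ((b - a) / real n)"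
          using Suc.prems ab by (intro mult_right_mono) auto
        then show ?thesis using \<open>n > 0\<close> by (simp add: \<tau>_def)
      qed
      ultimately have "(norm (w (\<tau> (Suc i))))\<^sup>2 - (norm (w (\<tau> i)))\<^sup>2
          \<le> 2 * e' * (K (\<tau> (Suc i)) - K (\<tau> i))"
        using mesh ab by (intro step) auto
      with Suc show ?case by (simp add: algebra_simps)
    qed
    from this[of n] have "(norm (w b))\<^sup>2 - (norm (w a))\<^sup>2 \<le> 2 * e' * K b"
      using \<open>n > 0\<close> by (simp add: \<tau>_def)
    also have "\<dots> \<le> e' * (2 * K b + 1)"
      using \<open>e' > 0\<close> by (simp add: algebra_simps)
    also have "\<dots> = e"
      using \<open>K b \<ge> 0\<close> by (simp add: e'_def)
    finally show ?thesis .
  qed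
  then have "(norm (w b))\<^sup>2 - (norm (w a))\<^sup>2 \<le> 0"
    by (rule field_le_epsilon[of _ 0, simplified])
  then show ?thesis
    by (simp add: power2_le_iff_abs_le)
qed

text \<open>The two subgradient inequalities, each tested at the other point, are added; the values
  of \<open>R\<close> cancel.\<close>

lemma subdifferential_monotone:
  assumes "u \<in> subdifferential R x" and "v \<in> subdifferential R y"
  shows "inner (u - v) (x - y) \<ge> 0"
proof -
  have "R y \<ge> R x + inner u (y - x)" "R x \<ge> R y + inner v (x - y)"
    using assms by (auto simp: subdifferential_def)
  then show ?thesis by (simp add: inner_diff_left inner_diff_right)
qed

text \<open>The difference of two solutions starts at 0, and monotonicity of \<open>- P\<close>
  makes its norm nonincreasing. The competitor \<open>v\<close> has to solve the equation only up to
  \<open>T\<close>, which suits a formula that is valid until extinction.\<close>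

lemma flow_unique:
  fixes u v :: "real \<Rightarrow> 'a::euclidean_space"
  assumes P: "\<And>x. - P x \<in> subdifferential R x"
    and u: "flow_solution P f u"
    and "T \<ge> 0" and "v 0 = f"
    and vP: "(\<lambda>s. P (v s)) absolutely_integrable_on {0..T}"
    and v: "\<And>t. t \<in> {0..T} \<Longrightarrow> ((\<lambda>s. P (v s)) has_integral (v t - v 0)) {0..t}"
  shows "u T = v T"
proof -
  have "norm (u T - v T) \<le> norm (u 0 - v 0)"
  proof (rule norm_le_of_dissipative_integral[where k = "\<lambda>s. P (u s) - P (v s)"])
    show "(\<lambda>s. P (u s) - P (v s)) absolutely_integrable_on {0..T}"
      using u vP \<open>T \<ge> 0\<close> unfolding flow_solution_def by (intro set_integral_diff) auto
    show "((\<lambda>s. P (u s) - P (v s)) has_integral (u t - v t - (u 0 - v 0))) {0..t}"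
      if "t \<in> {0..T}" for t
    proof -
      have "((\<lambda>s. P (u s)) has_integral (u t - u 0)) {0..t}"
        using u that unfolding flow_solution_def by auto
      from has_integral_diff[OF this v[OF that]] show ?thesis by (simp add: algebra_simps)
    qed
    show "inner (P (u t) - P (v t)) (u t - v t) \<le> 0" for t
      using subdifferential_monotone[OF P P, of "u t" "v t"]
      by (simp add: inner_diff_left inner_diff_right)
  qed (use \<open>T \<ge> 0\<close> in auto)
  then show ?thesis
    using u \<open>v 0 = f\<close> by (simp add: flow_solution_def)
qed

section \<open>Explicit solution along an eigenfunction and geometric data\<close>

text \<open>The positive part is dropped: the formula is only used up to the extinction time.\<close>

definition decay :: "real \<Rightarrow> real \<Rightarrow> real \<Rightarrow> real" where
  "decay p lam t = (1 + (2 - p) * lam * t) powr (1 / (2 - p))"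

lemma eigenfunction_flow:
  fixes f :: "'a::euclidean_space"
  assumes p: "p < 2" and lam: "lam < 0"
    and Pf: "P f = lam *\<^sub>R f"
    and hom: "\<And>c x. P (c *\<^sub>R x) = (c * \<bar>c\<bar> powr (p - 2)) *\<^sub>R P x"
    and sub: "\<And>x. - P x \<in> subdifferential R x"
    and u: "flow_solution P f u"
    and T: "T \<ge> 0" "1 + (2 - p) * lam * T \<ge> 0"
  shows "u T = decay p lam T *\<^sub>R f"
proof -
  define b where "b t = 1 + (2 - p) * lam * t" for t
  define a where "a t = decay p lam t" for t
  \<comment> \<open>Right-hand side of the scalar equation: \<open>P (a t *\<^sub>R f)\<close>
    equals \<open>g t *\<^sub>R f\<close>.\<close>
  define g where "g t = a t * \<bar>a t\<bar> powr (p - 2) * lam" for t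
  have b_pos: "b t > 0" if "t < T" for t
  proof -
    have "(2 - p) * lam * t > (2 - p) * lam * T"
      using p lam that by (intro mult_strict_left_mono_neg mult_pos_neg) auto
    then show ?thesis using T by (simp add: b_def)
  qed
  have cont: "continuous_on {0..T} a"
  proof -
    have "\<forall>t\<in>{0..T}. b t \<ge> 0"
      using b_pos T by (metis atLeastAtMost_iff b_def less_eq_real_def)
    then show ?thesis
      unfolding a_def decay_def b_def using p
      by (intro continuous_on_powr' continuous_intros) (auto simp: b_def)
  qed
  \<comment> \<open>Restricted to times before \<open>T\<close>, because the base of the power may
    vanish at \<open>T\<close>. The fundamental theorem of calculus then needs only continuity at
    the end points.\<close>
  have deriv: "(a has_real_derivative g t) (at t)" if "t < T" for t
  proof -
    have bt: "1 + (2 - p) * lam * t > 0" using b_pos[OF that] by (simp add: b_def)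
    have "g t = b t powr (1 / (2 - p)) * b t powr ((p - 2) / (2 - p)) * lam"
      by (simp add: g_def a_def decay_def b_def powr_powr)
    also have "\<dots> = b t powr (1 / (2 - p) + (p - 2) / (2 - p)) * lam"
      by (simp add: powr_add)
    also have "(p - 2) / (2 - p) = - 1" using p by (simp add: field_simps)
    finally have g: "g t = b t powr (1 / (2 - p) - 1) * lam" by simp
    have "((\<lambda>t. (1 + (2 - p) * lam * t) powr (1 / (2 - p))) has_real_derivative
        (1 / (2 - p)) * (1 + (2 - p) * lam * t) powr (1 / (2 - p) - 1) * ((2 - p) * lam)) (at t)"
      using bt by (intro DERIV_cong[OF DERIV_fun_powr[where g = "\<lambda>t. 1 + (2 - p) * lam * t"]])
        (auto intro!: derivative_eq_intros)
    moreover have "(1 / (2 - p)) * (1 + (2 - p) * lam * t) powr (1 / (2 - p) - 1) * ((2 - p) * lam) = g t"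
      using p by (simp add: g b_def)
    ultimately show ?thesis by (simp add: a_def[abs_def] decay_def[abs_def])
  qed
  have int: "(g has_integral (a t - a 0)) {0..t}" if "t \<in> {0..T}" for t
    using that deriv
    by (intro fundamental_theorem_of_calculus_interior)
      (auto simp flip: has_real_derivative_iff_has_vector_derivative
        intro: continuous_on_subset[OF cont])
  \<comment> \<open>As \<open>lam < 0\<close>, the function \<open>- g\<close> is nonnegative, so
    integrability already gives absolute integrability.\<close>
  have "(\<lambda>t. - g t) absolutely_integrable_on {0..T}"
  proof (rule nonnegative_absolutely_integrable_1)
    show "(\<lambda>t. - g t) integrable_on {0..T}"
      using int[of T] T by (auto intro: integrable_neg)
    show "0 \<le> - g t" for t
      using lam by (auto simp: g_def a_def decay_def mult_nonneg_nonpos)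
  qed
  from set_integrable_mult_right[OF this, of "-1"]
  have g_abs: "g absolutely_integrable_on {0..T}" by simp
  have Pa: "P (a t *\<^sub>R f) = g t *\<^sub>R f" for t
    by (simp add: hom Pf g_def)
  have "u T = a T *\<^sub>R f"
  proof (rule flow_unique[OF sub u \<open>T \<ge> 0\<close>])
    show "a 0 *\<^sub>R f = f" by (simp add: a_def decay_def)
    show "(\<lambda>s. P (a s *\<^sub>R f)) absolutely_integrable_on {0..T}"
      unfolding Pa by (rule set_integrable_scaleR_left) (use g_abs in auto)
    show "((\<lambda>s. P (a s *\<^sub>R f)) has_integral (a t *\<^sub>R f - a 0 *\<^sub>R f)) {0..t}"
      if "t \<in> {0..T}" for t
      unfolding Pa using has_integral_scaleR_left[OF int[OF that], of f]
      by (simp add: scaleR_diff_left)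
  qed
  then show ?thesis by (simp add: a_def)
qed

text \<open>The sample times are made so that the base of the power in \<open>decay\<close> becomes
  \<open>\<bar>1 - d\<bar>\<close> to the exponent \<open>k * (2 - p)\<close>; the outer exponent
  \<open>1 / (2 - p)\<close> then leaves the \<open>k\<close>-th power.\<close>

lemma decay_sample_time:
  assumes "p < 2" and "lam \<noteq> 0"
  shows "decay p lam (sample_time p lam d k) = \<bar>1 - d\<bar> ^ k"
proof -
  have "sample_time p lam d k = (rpow \<bar>1 - d\<bar> (real k * (2 - p)) - 1) / (lam * (2 - p))"
    by (simp add: sample_time_def diff_divide_distrib)
  then have "(2 - p) * lam * sample_time p lam d k = rpow \<bar>1 - d\<bar> (real k * (2 - p)) - 1"
    using assms by simp
  then have "decay p lam (sample_time p lam d k) = rpow \<bar>1 - d\<bar> (real k * (2 - p)) powr (1 / (2 - p))"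
    by (simp add: decay_def)
  also have "\<dots> = \<bar>1 - d\<bar> ^ k"
    \<comment> \<open>For \<open>k = 0\<close> the convention of \<open>rpow\<close> gives 1, also
      when \<open>d = 1\<close>. For \<open>k > 0\<close> and \<open>d = 1\<close> both sides
      vanish.\<close>
    using assms by (cases "k = 0"; cases "d = 1") (auto simp: rpow_def powr_powr powr_realpow)
  finally show ?thesis .
qed

lemma sampled_flow_geometric:
  fixes f :: "'a::euclidean_space"
  assumes p: "p < 2" and lam: "lam < 0" and d: "0 < d" "d < 2"
    and P: "homogeneous_operator p R P" and Pf: "P f = lam *\<^sub>R f"
    and psi: "sampled_flow P f (sample_time p lam d) N psi" and k: "k \<le> N"
  shows "psi k = \<bar>1 - d\<bar> ^ k *\<^sub>R f"
proof -
  obtain u where u: "flow_solution P f u" and "psi k = u (sample_time p lam d k)"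
    using psi k by (auto simp: sampled_flow_def)
  define q where "q = rpow \<bar>1 - d\<bar> (real k * (2 - p))"
  \<comment> \<open>The bound \<open>q \<le> 1\<close> makes the sample time nonnegative, and
    \<open>0 \<le> q\<close> keeps it from passing the extinction time. Both rest on
    \<open>\<bar>1 - d\<bar> < 1\<close>.\<close>
  have q: "0 \<le> q" "q \<le> 1"
    using d p by (auto simp: q_def rpow_def intro!: powr_le1)
  have t: "sample_time p lam d k = (q - 1) / (lam * (2 - p))"
    by (simp add: sample_time_def q_def diff_divide_distrib)
  have "u (sample_time p lam d k) = decay p lam (sample_time p lam d k) *\<^sub>R f"
  proof (rule eigenfunction_flow[OF p lam Pf _ _ u])
    show "0 \<le> sample_time p lam d k"
      unfolding t using q p lam by (intro divide_nonpos_neg mult_neg_pos) auto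
    show "0 \<le> 1 + (2 - p) * lam * sample_time p lam d k"
      using q p lam by (simp add: t)
  qed (use P in \<open>auto simp: homogeneous_operator_def\<close>)
  with \<open>psi k = _\<close> show ?thesis
    using p lam by (simp add: decay_sample_time)
qed

text \<open>The iterates stay on the line through \<open>f\<close>, where the step size turns each
  update into multiplication by \<open>1 - d\<close>. For \<open>d > 1\<close> the signs alternate,
  unlike for the sampled flow.\<close>

lemma explicit_scheme_geometric:
  fixes f :: "'a::real_inner"
  assumes f: "f \<noteq> 0" and lam: "lam \<noteq> 0"
    and hom: "\<And>c x. P (c *\<^sub>R x) = (c * \<bar>c\<bar> powr (p - 2)) *\<^sub>R P x" and Pf: "P f = lam *\<^sub>R f"
    and psi: "explicit_scheme P f d N psi"
  shows "k \<le> N \<Longrightarrow> psi k = (1 - d) ^ k *\<^sub>R f"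
proof (induction k)
  case 0
  then show ?case using psi by (simp add: explicit_scheme_def)
next
  case (Suc k)
  define c where "c = (1 - d) ^ k"
  have IH: "psi k = c *\<^sub>R f" using Suc by (simp add: c_def)
  have next_psi: "psi (Suc k) =
      (if psi k = 0 then 0 else psi k + step_size P d (psi k) *\<^sub>R P (psi k))"
    using psi Suc.prems by (simp add: explicit_scheme_def)
  show ?case
  proof (cases "c = 0")
    \<comment> \<open>Reached only if \<open>d = 1\<close> and \<open>k > 0\<close>: the scheme has
      hit 0 and stays there by convention.\<close>
    case True
    then show ?thesis using next_psi IH by (simp add: c_def)
  next
    case False
    define q where "q = c * \<bar>c\<bar> powr (p - 2) * lam"
    have q: "q \<noteq> 0" using False lam by (simp add: q_def)
    have Pk: "P (psi k) = q *\<^sub>R f" by (simp add: IH hom Pf q_def)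
    \<comment> \<open>Both \<open>psi k\<close> and \<open>P (psi k)\<close> are multiples of
      \<open>f\<close>, so the quotient in the step size reduces to \<open>c / q\<close>.\<close>
    have "step_size P d (psi k) * q = - c * d"
    proof -
      have "step_size P d (psi k) = - (q * c * (inner f f) / (q\<^sup>2 * inner f f)) * d"
        unfolding step_size_def Pk power2_norm_eq_inner by (simp add: IH power2_eq_square)
      then show ?thesis using f q by (simp add: power2_eq_square)
    qed
    then have "psi (Suc k) = c *\<^sub>R f + (- c * d) *\<^sub>R f"
      using next_psi False f by (simp add: IH Pk[unfolded IH])
    then show ?thesis by (simp add: c_def algebra_simps)
  qed
qed

section \<open>Linear algebra: rank-one singular value decomposition and scalar inverses\<close>

text \<open>In the singular bases, \<open>A\<close> becomes the matrix \<open>S\<close>, which is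
  diagonal and also a product of a column \<open>B\<close> and a row \<open>C\<close>. Since the top
  singular value is nonzero, \<open>B\<close> is supported on entry 0, so that \<open>U * B\<close>
  is a multiple of the first column of \<open>U\<close>.\<close>

lemma svd_rank_one_leading_col:
  fixes A :: "real mat"
  assumes svd: "is_svd A U S V" and A: "A \<in> carrier_mat n m"
    and rank1: "\<And>i j. i < n \<Longrightarrow> j < m \<Longrightarrow> A $$ (i, j) = g i * x j"
    and nz: "i\<^sub>0 < n" "g i\<^sub>0 \<noteq> 0" "j\<^sub>0 < m" "x j\<^sub>0 \<noteq> 0"
  obtains a where "\<And>i. i < n \<Longrightarrow> g i = a * U $$ (i, 0)"
proof -
  have car: "U \<in> carrier_mat n n" "S \<in> carrier_mat n m" "V \<in> carrier_mat m m"
    and UU: "transpose_mat U * U = 1\<^sub>m n" and VV: "transpose_mat V * V = 1\<^sub>m m"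
    and diag: "diagonal_mat S"
    and S_pos: "\<And>i. i < min n m \<Longrightarrow> S $$ (i, i) \<ge> 0"
    and S_dec: "\<And>i j. i \<le> j \<Longrightarrow> j < min n m \<Longrightarrow> S $$ (i, i) \<ge> S $$ (j, j)"
    and A_eq: "A = U * S * transpose_mat V"
    using svd A unfolding is_svd_def by auto
  have UU': "U * transpose_mat U = 1\<^sub>m n"
    using UU car by (intro mat_mult_left_right_inverse[of "transpose_mat U"]) auto
  define G where "G = mat n 1 (\<lambda>(i, j). g i)"
  define X where "X = mat 1 m (\<lambda>(i, j). x j)"
  have GX: "G \<in> carrier_mat n 1" "X \<in> carrier_mat 1 m" by (auto simp: G_def X_def)
  define B where "B = transpose_mat U * G"
  define C where "C = X * V"
  have BC: "B \<in> carrier_mat n 1" "C \<in> carrier_mat 1 m"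
    using GX car by (auto simp: B_def C_def)
  have "A = G * X"
    using A GX by (intro eq_matI) (auto simp: rank1 G_def X_def scalar_prod_def)
  have "S = transpose_mat U * (U * S * transpose_mat V) * V"
  proof -
    have "transpose_mat U * (U * S * transpose_mat V) * V
        = (transpose_mat U * U) * S * (transpose_mat V * V)"
      using car by (simp add: assoc_mult_mat[where n\<^sub>2 = n and n\<^sub>3 = m and n\<^sub>4 = m]
        assoc_mult_mat[where n\<^sub>2 = n and n\<^sub>3 = n and n\<^sub>4 = m]
        assoc_mult_mat[where n\<^sub>2 = m and n\<^sub>3 = m and n\<^sub>4 = m])
    then show ?thesis using car by (simp add: UU VV)
  qed
  also have "\<dots> = transpose_mat U * (G * X) * V"
    using A_eq \<open>A = G * X\<close> by simp
  also have "\<dots> = B * C"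
  proof -
    have "transpose_mat U * (G * X) = B * X"
      unfolding B_def using car GX by (intro assoc_mult_mat[symmetric]) auto
    then show ?thesis
      unfolding C_def using BC(1) car GX by (simp add: assoc_mult_mat[OF BC(1) GX(2) car(3)])
  qed
  finally have S_BC: "S = B * C" .
  have S_entry: "S $$ (i, j) = B $$ (i, 0) * C $$ (0, j)" if "i < n" "j < m" for i j
    using BC that by (simp add: S_BC scalar_prod_def)
  \<comment> \<open>If this entry vanished, so would the largest singular value, hence by the
    ordering all of them, and \<open>A\<close> would be 0.\<close>
  have C0: "C $$ (0, 0) \<noteq> 0"
  proof
    assume C0: "C $$ (0, 0) = 0"
    have "S $$ (0, 0) = 0" using S_entry[of 0 0] nz C0 by auto
    then have "S $$ (i, i) = 0" if "i < min n m" for i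
      using S_pos[of i] S_dec[of 0 i] that by auto
    then have "S = 0\<^sub>m n m"
      using diag car by (intro eq_matI) (simp_all add: diagonal_mat_def, metis)
    then have "A = 0\<^sub>m n m"
      using car by (simp add: A_eq)
    then show False
      using rank1[of i\<^sub>0 j\<^sub>0] nz by simp
  qed
  have B0: "B $$ (i, 0) = 0" if "0 < i" "i < n" for i
  proof -
    have "S $$ (i, 0) = 0" using diag that car nz by (auto simp: diagonal_mat_def)
    then show ?thesis using S_entry[of i 0] that nz C0 by auto
  qed
  have UB: "U * B = G"
    using car GX UU' by (simp add: B_def flip: assoc_mult_mat[where n\<^sub>2 = n and n\<^sub>3 = n and n\<^sub>4 = 1])
  have "g i = B $$ (0, 0) * U $$ (i, 0)" if i: "i < n" for i
  proof -
    have "g i = (U * B) $$ (i, 0)" using i by (simp add: UB G_def)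
    also have "\<dots> = (\<Sum>k = 0..<n. U $$ (i, k) * B $$ (k, 0))"
      using i car BC by (simp add: scalar_prod_def)
    also have "\<dots> = (\<Sum>k = 0..<n. if k = 0 then U $$ (i, 0) * B $$ (0, 0) else 0)"
      using B0 by (intro sum.cong) auto
    finally show ?thesis using i by simp
  qed
  then show thesis by (rule that)
qed

text \<open>A nonzero entry makes the determinant nonzero, so \<open>mat_inverse\<close> returns
  \<open>Some\<close> and the use of \<open>the\<close> in \<open>dmd_matrix\<close> is
  meaningful.\<close>

lemma mat_inverse_1x1:
  fixes Z :: "'a::field mat"
  assumes Z: "Z \<in> carrier_mat 1 1" and "Z $$ (0, 0) \<noteq> 0"
  shows "Z * the (mat_inverse Z) = 1\<^sub>m 1" "the (mat_inverse Z) \<in> carrier_mat 1 1"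
proof -
  have "det Z \<noteq> 0" using assms by (simp add: det_single)
  then have "Z \<in> Units (ring_mat TYPE('a) 1 ())"
    by (rule det_non_zero_imp_unit[OF Z])
  then obtain B where "mat_inverse Z = Some B"
    using mat_inverse(1)[OF Z, of "()"] by (cases "mat_inverse Z") auto
  with mat_inverse(2)[OF Z this]
  show "Z * the (mat_inverse Z) = 1\<^sub>m 1" "the (mat_inverse Z) \<in> carrier_mat 1 1"
    by auto
qed

section \<open>Coordinates and snapshot matrices\<close>

lemma coords_dim [simp]: "dim_vec (coords (x :: real ^ 'm)) = CARD('m)"
  by (simp add: coords_def)

lemma coords_scaleR: "i < CARD('m) \<Longrightarrow>
    vec_index (coords (c *\<^sub>R (x :: real ^ 'm))) i = c * vec_index (coords x) i"
  by (simp add: coords_def)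

text \<open>The enumeration behind \<open>coords\<close> reaches every index, with
  \<open>to_nat_on\<close> as its inverse. This yields a nonzero coordinate of
  \<open>f\<close>.\<close>

lemma coords_eq_0_iff: "(\<forall>i<CARD('m). vec_index (coords x) i = 0) \<longleftrightarrow> (x :: real ^ 'm) = 0"
proof
  assume *: "\<forall>i<CARD('m). vec_index (coords x) i = 0"
  have "vec_nth x j = 0" for j
  proof -
    have "to_nat_on (UNIV :: 'm set) j < CARD('m)"
      using bij_betwE[OF to_nat_on_finite[of "UNIV :: 'm set"]] by auto
    then show ?thesis using * by (auto simp: coords_def)
  qed
  then show "x = 0" by (simp add: Finite_Cartesian_Product.vec_eq_iff)
qed (simp add: coords_def)

lemma snapshots_carrier [simp]:
  "snapshots a b (psi :: nat \<Rightarrow> real ^ 'm) \<in> carrier_mat CARD('m) (b - a)"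
  unfolding snapshots_def by (metis length_map length_upt mat_of_cols_carrier(1))

lemma snapshots_index:
  "i < CARD('m) \<Longrightarrow> j < b - a \<Longrightarrow>
    snapshots a b (psi :: nat \<Rightarrow> real ^ 'm) $$ (i, j) = vec_index (coords (psi (a + j))) i"
  by (simp add: snapshots_def mat_of_cols_index)

lemma leading_cols_1:
  assumes "U \<in> carrier_mat n n" and "n > 0"
  shows "leading_cols 1 U = mat n 1 (\<lambda>(i, j). U $$ (i, 0))"
proof -
  have "take 1 (cols U) = [col U 0]"
    using assms by (cases n) (auto simp: cols_def upt_rec)
  then show ?thesis
    using assms by (intro eq_matI) (auto simp: leading_cols_def mat_of_cols_index)
qed

section \<open>One-dimensional DMD of geometric data\<close>

text \<open>The ratio \<open>c\<close> is an arbitrary real, which covers alternating data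
  (\<open>c < 0\<close>) and data extinct after the first snapshot (\<open>c = 0\<close>).\<close>

lemma dmd_geometric_data_exact:
  fixes f :: "real ^ 'm" and psi :: "nat \<Rightarrow> real ^ 'm"
  assumes f: "f \<noteq> 0" and N: "N \<ge> 1"
    and psi: "\<And>k. k \<le> N \<Longrightarrow> psi k = c ^ k *\<^sub>R f"
    and dmd: "is_dmd 1 N psi U mu w"
  shows "reconstruction_error 1 N psi U mu w = 0"
proof -
  define g where "g = vec_index (coords f)"
  define L where "L = leading_cols 1 U"
  obtain S V where svd: "is_svd (snapshots 0 N psi) U S V"
    and eig: "eigensystem 1 (map_mat complex_of_real (dmd_matrix 1 U N psi)) mu w"
    using dmd by (auto simp: is_dmd_def)
  have coords_psi: "vec_index (coords (psi k)) i = c ^ k * g i"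
    if "k \<le> N" "i < CARD('m)" for k i
    using that by (simp add: psi coords_scaleR g_def)
  obtain i\<^sub>0 where i\<^sub>0: "i\<^sub>0 < CARD('m)" "g i\<^sub>0 \<noteq> 0"
    using f coords_eq_0_iff[of f] by (auto simp: g_def)
  have U: "U \<in> carrier_mat CARD('m) CARD('m)" and UU: "transpose_mat U * U = 1\<^sub>m CARD('m)"
    using svd snapshots_carrier[of 0 N psi] unfolding is_svd_def by auto
  obtain a where g: "\<And>i. i < CARD('m) \<Longrightarrow> g i = a * U $$ (i, 0)"
  proof (rule svd_rank_one_leading_col[OF svd snapshots_carrier])
    show "snapshots 0 N psi $$ (i, j) = g i * c ^ j" if "i < CARD('m)" "j < N - 0" for i j
      using that by (simp add: snapshots_index coords_psi)
    \<comment> \<open>Column 0 serves as the nonzero column: \<open>c ^ 0 = 1\<close> even for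
      \<open>c = 0\<close>, and \<open>N \<ge> 1\<close> ensures that the column exists.\<close>
    show "0 < N - 0" "c ^ 0 \<noteq> 0" using N by auto
  qed (use i\<^sub>0 in auto)
  have "a \<noteq> 0" using i\<^sub>0 g by fastforce
  have unit: "(\<Sum>i = 0..<CARD('m). U $$ (i, 0) * U $$ (i, 0)) = 1"
  proof -
    have "(transpose_mat U * U) $$ (0, 0) = 1" by (simp add: UU)
    then show ?thesis using U by (simp add: scalar_prod_def)
  qed
  have L: "L = mat CARD('m) 1 (\<lambda>(i, j). U $$ (i, 0))"
    unfolding L_def using U by (intro leading_cols_1) auto
  \<comment> \<open>The first column of \<open>U\<close> is a unit vector and \<open>f\<close> is
    \<open>a\<close> times it, so projecting \<open>b\<close> times \<open>f\<close> gives
    \<open>a * b\<close>.\<close>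
  have proj: "(\<Sum>i = 0..<CARD('m). U $$ (i, 0) * (b * g i)) = a * b" for b
  proof -
    have "(\<Sum>i = 0..<CARD('m). U $$ (i, 0) * (b * g i))
        = (\<Sum>i = 0..<CARD('m). a * b * (U $$ (i, 0) * U $$ (i, 0)))"
      by (intro sum.cong) (auto simp: g)
    then show ?thesis by (simp add: unit flip: sum_distrib_left)
  qed
  define X where "X = transpose_mat L * snapshots 0 N psi"
  define Y where "Y = transpose_mat L * snapshots 1 (N + 1) psi"
  have X: "X = mat 1 N (\<lambda>(i, j). a * c ^ j)"
    using snapshots_carrier[of 0 N psi]
    by (intro eq_matI)
      (auto simp: X_def L scalar_prod_def snapshots_index coords_psi proj)
  have "Y = mat 1 N (\<lambda>(i, j). a * c ^ Suc j)"
    using snapshots_carrier[of 1 "N + 1" psi]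
    by (intro eq_matI)
      (auto simp: Y_def L scalar_prod_def snapshots_index coords_psi proj simp del: power_Suc)
  \<comment> \<open>Shifting by one snapshot multiplies by \<open>c\<close>, so the least-squares
    fit is exact.\<close>
  then have Y: "Y = c \<cdot>\<^sub>m X"
    by (auto simp: X)
  define Z where "Z = X * transpose_mat X"
  have Z: "Z \<in> carrier_mat 1 1" by (auto simp: Z_def X)
  have "Z $$ (0, 0) = (\<Sum>j = 0..<N. (a * c ^ j)\<^sup>2)"
    by (simp add: Z_def X scalar_prod_def power2_eq_square)
  \<comment> \<open>The summand for \<open>j = 0\<close> is the square of \<open>a\<close>, so the
    Gram matrix is invertible for every \<open>c\<close>.\<close>
  moreover have "(a * c ^ 0)\<^sup>2 \<le> (\<Sum>j = 0..<N. (a * c ^ j)\<^sup>2)"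
    using N by (intro member_le_sum) auto
  ultimately have "Z $$ (0, 0) \<noteq> 0"
    using \<open>a \<noteq> 0\<close> by (smt (verit) mult_cancel_left1 power_0 zero_less_power2)
  note inv = mat_inverse_1x1[OF Z this]
  have "dmd_matrix 1 U N psi = c \<cdot>\<^sub>m 1\<^sub>m 1"
  proof -
    have "dmd_matrix 1 U N psi = (c \<cdot>\<^sub>m X) * transpose_mat X * the (mat_inverse Z)"
      unfolding Y[symmetric] by (simp only: dmd_matrix_def Let_def X_def Y_def Z_def L_def)
    also have "(c \<cdot>\<^sub>m X) * transpose_mat X = c \<cdot>\<^sub>m Z"
      unfolding Z_def by (rule mult_smult_assoc_mat) (auto simp: X)
    also have "c \<cdot>\<^sub>m Z * the (mat_inverse Z) = c \<cdot>\<^sub>m (Z * the (mat_inverse Z))"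
      by (rule mult_smult_assoc_mat[OF Z inv(2)])
    finally show ?thesis by (simp add: inv(1))
  qed
  then have F: "map_mat complex_of_real (dmd_matrix 1 U N psi) = complex_of_real c \<cdot>\<^sub>m 1\<^sub>m 1"
    by (intro eq_matI) auto
  have mu: "mu 0 = c"
  proof -
    have "char_poly (complex_of_real c \<cdot>\<^sub>m 1\<^sub>m 1) = [:- complex_of_real c, 1:]"
      by (subst char_poly_upper_triangular[where n = 1]) (auto simp: diag_mat_def)
    also have "char_poly (complex_of_real c \<cdot>\<^sub>m 1\<^sub>m 1) = (\<Prod>i<1. [:- mu i, 1:])"
      using eig unfolding eigensystem_def F by blast
    finally show ?thesis by simp
  qed
  have w: "dim_vec (w 0) = 1" and "w 0 \<bullet>c w 0 = 1"
    using eig by (auto simp: eigensystem_def F eigenvector_def simp del: One_nat_def)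
  \<comment> \<open>Normalization leaves only a phase in \<open>w 0\<close>, and it cancels between
    the conjugated coordinate and the mode.\<close>
  then have w_unit: "vec_index (w 0) 0 * cnj (vec_index (w 0) 0) = 1"
    by (simp add: scalar_prod_def)
  have coordinate: "dmd_coordinate 1 U (psi 0) (w 0) = a * cnj (vec_index (w 0) 0)"
    using w proj[of 1] coords_psi[of 0]
    by (simp add: dmd_coordinate_def L[unfolded L_def, simplified] scalar_prod_def)
  have mode: "vec_index (dmd_mode 1 U (w 0)) j = U $$ (j, 0) * vec_index (w 0) 0"
    if "j < CARD('m)" for j
    using w that by (simp add: dmd_mode_def L[unfolded L_def, simplified] scalar_prod_def)
  have "vec_index (dmd_reconstruction 1 psi U mu w k) j = vec_index (coords (psi k)) j"
    if "k \<le> N" "j < CARD('m)" for k j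
  proof -
    have "vec_index (dmd_reconstruction 1 psi U mu w k) j
        = (a * c ^ k * U $$ (j, 0)) * (vec_index (w 0) 0 * cnj (vec_index (w 0) 0))"
      using that coordinate mode by (simp add: dmd_reconstruction_def mu)
    also have "\<dots> = vec_index (coords (psi k)) j"
      unfolding w_unit using that by (simp add: coords_psi g)
    finally show ?thesis .
  qed
  then show ?thesis
    by (simp add: reconstruction_error_def)
qed

text \<open>Exactness is claimed for every admissible choice of singular vectors and eigenvectors.
  With \<open>N \<ge> 1\<close> there is a snapshot to fit; an empty snapshot matrix would give a
  singular Gram matrix.\<close>

theorem theorem2:
  fixes R :: "real ^ 'm \<Rightarrow> real" and P :: "real ^ 'm \<Rightarrow> real ^ 'm" and f :: "real ^ 'm"
    and p lam d :: real and N :: nat and psi :: "nat \<Rightarrow> real ^ 'm"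
    and U :: "real mat" and mu :: "nat \<Rightarrow> complex" and w :: "nat \<Rightarrow> complex Matrix.vec"
  assumes "1 \<le> p" and "p < 2"
    and "homogeneous_operator p R P"
    and "f \<noteq> 0" and "P f = lam *\<^sub>R f" and "lam < 0"
    and "0 < d" and "d < 2"
    and "N \<ge> 1"
    and "sampled_flow P f (sample_time p lam d) N psi \<or> explicit_scheme P f d N psi"
    and "is_dmd 1 N psi U mu w"
  shows "reconstruction_error 1 N psi U mu w = 0"
proof -
  have hom: "P (c *\<^sub>R x) = (c * \<bar>c\<bar> powr (p - 2)) *\<^sub>R P x" for c x
    using assms(3) by (simp add: homogeneous_operator_def)
  have "\<exists>c. \<forall>k\<le>N. psi k = c ^ k *\<^sub>R f"
    using assms(10)
  proof
    assume "sampled_flow P f (sample_time p lam d) N psi"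
    then show ?thesis
      using sampled_flow_geometric assms by blast
  next
    assume "explicit_scheme P f d N psi"
    then show ?thesis
      using explicit_scheme_geometric[OF \<open>f \<noteq> 0\<close> _ hom \<open>P f = lam *\<^sub>R f\<close>] \<open>lam < 0\<close> by blast
  qed
  then obtain c where "\<And>k. k \<le> N \<Longrightarrow> psi k = c ^ k *\<^sub>R f"
    by blast
  then show ?thesis
    using dmd_geometric_data_exact assms by blast
qed

end
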